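(* Let $d\ge 2$, let $\Lambda_\omega$ be a non-negative self-adjoint operator with domain $\mathrm{dom}(\Lambda_\omega)\subset L^2(\mathbb{S}^{d-1};d\omega)$, and assume that $\Lambda_\omega$ has purely discrete spectrum, consisting of isolated eigenvalues $\lambda_m$, $m\in\mathcal{I}$ (repeated according to multiplicity, $\mathcal I$ a countable index set), which can accumulate only at infinity, with corresponding normalized eigenfunctions $u_m$, $m\in\mathcal{I}$. Let $\mathcal{L}=L_r+\frac{1}{r^2}\Lambda_\omega$, $\mathrm{dom}(\mathcal{L})$ and $\mathcal{D}$ be as defined in the context. Let $\beta\in\mathbb{R}$. Then for all $\psi\in\mathrm{dom}(\mathcal{L})$ such that $|\cdot|^{-\beta/2}\mathcal{D}(\psi)^{1/2}\in L^2(\mathbb{R}^d)$ we have $$\int_{\mathbb{R}^d}\frac{\mathcal{D}(\psi)(x)}{|x|^\beta}\,dx\ \ge\ C_{\mathcal{D}}(d,\beta)\int_{\mathbb{R}^d}\frac{|\psi(x)|^2}{|x|^{\beta+2}}\,dx,\qquad C_{\mathcal{D}}(d,\beta)=\min_{m\in\mathcal{I}}\Big\{\lambda_m+\Big(\frac{d-\beta-2}{2}\Big)^2\Big\}.$$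
   Context: Write $x\in\mathbb{R}^d\setminus\{0\}$ in spherical coordinates as $x=r\omega$, $r=|x|>0$, $\omega\in\mathbb{S}^{d-1}$; functions are complex-valued. Set $L_r:=-\frac{\partial^2}{\partial r^2}-\frac{d-1}{r}\frac{\partial}{\partial r}$. The operator $\mathcal{L}:=L_r+\frac{1}{r^2}\Lambda_\omega$ (with $\Lambda_\omega$ acting in the variable $\omega$) acts on $$\mathrm{dom}(\mathcal{L}):=\{\psi:\ \psi\in C_0^\infty(\mathbb{R}^d\setminus\{0\}),\ \psi(r,\cdot)\in\mathrm{dom}(\Lambda_\omega)\text{ for } r>0,\ \mathcal{L}\psi\in L^2(\mathbb{R}^d)\}.$$ The first-order operator $\mathcal{D}$ is $\mathcal{D}(\psi):=\big|\frac{\partial\psi}{\partial r}\big|^2+\frac{1}{r^2}|\Lambda_\omega^{1/2}\psi|^2$, where $\Lambda_\omega^{1/2}$ is the non-negative self-adjoint square root of $\Lambda_\omega$ given by the functional calculus (so $\Lambda_\omega^{1/2}u_m=\sqrt{\lambda_m}\,u_m$). *)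

theory Defs
  imports "HOL-Analysis.Analysis"
begin

section \<open>Square-integrable functions\<close>

text \<open>Elements of the Hilbert space \<open>L\<^sup>2(M)\<close> are handled through their representatives; two
  representatives denote the same element iff they agree almost everywhere on \<open>space M\<close>.\<close>

definition L2 :: "'a measure \<Rightarrow> ('a \<Rightarrow> complex) set" where
  "L2 M = {f. f \<in> borel_measurable M \<and> integrable M (\<lambda>x. (cmod (f x))\<^sup>2)}"

definition l2_inner :: "'a measure \<Rightarrow> ('a \<Rightarrow> complex) \<Rightarrow> ('a \<Rightarrow> complex) \<Rightarrow> complex" where
  "l2_inner M f g = (LINT x|M. f x * cnj (g x))"

definition l2_norm :: "'a measure \<Rightarrow> ('a \<Rightarrow> complex) \<Rightarrow> real" where
  "l2_norm M f = sqrt (LINT x|M. (cmod (f x))\<^sup>2)"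


section \<open>Unbounded operators on \<open>L\<^sup>2\<close>\<close>

text \<open>An unbounded operator is given by its graph: \<open>(f, h) \<in> T\<close> means that \<open>f\<close> represents an
  element of the domain and \<open>h\<close> represents its image. The graph contains all representatives,
  so the domain is \<^term>\<open>Domain T\<close> and composition of operators (with its natural
  domain) is relational composition \<^term>\<open>T O T\<close>. For a self-adjoint \<open>T\<close> in the sense below,
  linearity, single-valuedness (almost everywhere), and closure under change of representatives
  are consequences of \<open>T\<close> being the adjoint of a densely defined operator.\<close>

type_synonym 'a l2_op = "(('a \<Rightarrow> complex) \<times> ('a \<Rightarrow> complex)) set"

definition densely_defined :: "'a measure \<Rightarrow> 'a l2_op \<Rightarrow> bool" where
  "densely_defined M T \<longleftrightarrow>
     (\<forall>f \<in> L2 M. \<forall>e > 0. \<exists>g \<in> Domain T \<inter> L2 M. l2_norm M (\<lambda>x. f x - g x) < e)"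

definition adjoint_op :: "'a measure \<Rightarrow> 'a l2_op \<Rightarrow> 'a l2_op" where
  "adjoint_op M T = {(g, h). g \<in> L2 M \<and> h \<in> L2 M \<and>
     (\<forall>(f, k) \<in> T. l2_inner M k g = l2_inner M f h)}"

definition self_adjoint_op :: "'a measure \<Rightarrow> 'a l2_op \<Rightarrow> bool" where
  "self_adjoint_op M T \<longleftrightarrow> densely_defined M T \<and> adjoint_op M T = T"

text \<open>The quadratic form of a self-adjoint operator is real, so taking the real part loses nothing.\<close>

definition nonneg_op :: "'a measure \<Rightarrow> 'a l2_op \<Rightarrow> bool" where
  "nonneg_op M T \<longleftrightarrow> (\<forall>(f, k) \<in> T. 0 \<le> Re (l2_inner M k f))"

definition nonneg_sqrt_op :: "'a measure \<Rightarrow> 'a l2_op \<Rightarrow> 'a l2_op \<Rightarrow> bool" where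
  "nonneg_sqrt_op M T S \<longleftrightarrow> self_adjoint_op M S \<and> nonneg_op M S \<and> S O S = T"

text \<open>\<open>z\<close> is in the resolvent set iff \<open>T - z\<close> maps its domain onto \<open>L\<^sup>2(M)\<close>, and is injective with
  bounded inverse (the lower bound).\<close>

definition resolvent_set_op :: "'a measure \<Rightarrow> 'a l2_op \<Rightarrow> complex set" where
  "resolvent_set_op M T = {z.
     (\<forall>h \<in> L2 M. \<exists>(f, k) \<in> T. AE x in M. k x - z * f x = h x) \<and>
     (\<exists>C. \<forall>(f, k) \<in> T. l2_norm M f \<le> C * l2_norm M (\<lambda>x. k x - z * f x))}"

definition spectrum_op :: "'a measure \<Rightarrow> 'a l2_op \<Rightarrow> complex set" where
  "spectrum_op M T = - resolvent_set_op M T"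

text \<open>Purely discrete spectrum: the spectrum consists of the eigenvalues \<open>lam m\<close> (\<open>m \<in> I\<close>), and
  for each value \<open>\<mu>\<close> the normalized eigenfunctions \<open>u m\<close> with \<open>lam m = \<mu>\<close> form a basis of the
  eigenspace of \<open>\<mu>\<close>; that is, the family is repeated according to multiplicity. As every bounded
  part of the (repeated) family is finite, eigenvalues are isolated with finite multiplicity and
  accumulate only at infinity; the operator is bounded below, hence one-sided bounds suffice.
  Orthogonality of eigenfunctions inside one eigenspace is not needed, only linear independence.\<close>

definition purely_discrete_spectrum ::
  "'a measure \<Rightarrow> 'a l2_op \<Rightarrow> 'i set \<Rightarrow> ('i \<Rightarrow> real) \<Rightarrow> ('i \<Rightarrow> 'a \<Rightarrow> complex) \<Rightarrow> bool" where
  "purely_discrete_spectrum M T I lam u \<longleftrightarrow>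
     countable I \<and>
     spectrum_op M T = complex_of_real ` lam ` I \<and>
     (\<forall>R. finite {m \<in> I. lam m \<le> R}) \<and>
     (\<forall>m \<in> I. (u m, \<lambda>x. complex_of_real (lam m) * u m x) \<in> T \<and> l2_norm M (u m) = 1) \<and>
     (\<forall>\<mu> a. (AE x in M. (\<Sum>m | m \<in> I \<and> lam m = \<mu>. a m * u m x) = 0) \<longrightarrow>
        (\<forall>m \<in> I. lam m = \<mu> \<longrightarrow> a m = 0)) \<and>
     (\<forall>\<mu> f. (f, \<lambda>x. complex_of_real \<mu> * f x) \<in> T \<longrightarrow>
        (\<exists>a. AE x in M. f x = (\<Sum>m | m \<in> I \<and> lam m = \<mu>. a m * u m x)))"


section \<open>Surface measure on the unit sphere\<close>

text \<open>The surface measure of \<open>A\<close> in the unit sphere of a \<open>d\<close>-dimensional space is \<open>d\<close> times the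
  Lebesgue measure of the cone \<open>{t *\<^sub>R \<omega> | 0 < t < 1, \<omega> \<in> A}\<close>.\<close>

definition sphere_measure :: "'a::euclidean_space measure" where
  "sphere_measure = scale_measure (ennreal (real DIM('a)))
     (distr (restrict_space lborel (ball 0 1 - {0})) (restrict_space borel (sphere 0 1)) sgn)"


section \<open>Test functions and radial derivatives\<close>

primrec Ck :: "nat \<Rightarrow> ('a::real_normed_vector \<Rightarrow> 'b::real_normed_vector) \<Rightarrow> bool" where
  "Ck 0 f \<longleftrightarrow> continuous_on UNIV f"
| "Ck (Suc k) f \<longleftrightarrow> (\<forall>x. f differentiable (at x)) \<and>
     (\<forall>v. Ck k (\<lambda>x. frechet_derivative f (at x) v))"

text \<open>\<open>C\<^sub>0\<^sup>\<infinity>(\<real>\<^sup>d - {0})\<close>, every function being extended by 0 to the origin.\<close>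

definition test_functions :: "('a::euclidean_space \<Rightarrow> complex) set" where
  "test_functions = {\<psi>. (\<forall>k. Ck k \<psi>) \<and>
     compact (closure {x. \<psi> x \<noteq> 0}) \<and> 0 \<notin> closure {x. \<psi> x \<noteq> 0}}"

definition radial_deriv :: "('a::euclidean_space \<Rightarrow> complex) \<Rightarrow> 'a \<Rightarrow> complex" where
  "radial_deriv \<psi> x = vector_derivative (\<lambda>r. \<psi> (r *\<^sub>R sgn x)) (at (norm x))"

definition radial_op :: "('a::euclidean_space \<Rightarrow> complex) \<Rightarrow> 'a \<Rightarrow> complex" where
  "radial_op \<psi> x = - radial_deriv (radial_deriv \<psi>) x
     - complex_of_real ((real DIM('a) - 1) / norm x) * radial_deriv \<psi> x"


section \<open>Operators acting in the angular variable\<close>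

definition slice :: "('a::euclidean_space \<Rightarrow> complex) \<Rightarrow> real \<Rightarrow> 'a \<Rightarrow> complex" where
  "slice f r = (\<lambda>\<omega>. f (r *\<^sub>R \<omega>))"

text \<open>An operator \<open>T\<close> on the sphere determines \<open>(T \<psi>(r, \<cdot>))(\<omega>)\<close>, for each \<open>r\<close>, only up to a null set
  of angles. The function \<open>T\<psi>\<close> on \<open>\<real>\<^sup>d\<close> is therefore only defined almost everywhere;
  \<open>angular_image T \<psi> g\<close> says that the measurable function \<open>g\<close> is a version of it. Any two
  versions agree almost everywhere.\<close>

definition angular_image ::
  "'a::euclidean_space l2_op \<Rightarrow> ('a \<Rightarrow> complex) \<Rightarrow> ('a \<Rightarrow> complex) \<Rightarrow> bool" where
  "angular_image T \<psi> g \<longleftrightarrow> g \<in> borel_measurable borel \<and>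
     (AE r in lborel. 0 < r \<longrightarrow> (slice \<psi> r, slice g r) \<in> T)"

text \<open>Domain of \<open>L\<^sub>r + r\<^sup>-\<^sup>2 \<Lambda>\<close>.\<close>

definition dom_L :: "'a::euclidean_space l2_op \<Rightarrow> ('a \<Rightarrow> complex) set" where
  "dom_L \<Lambda> = {\<psi> \<in> test_functions.
     (\<forall>r > 0. slice \<psi> r \<in> Domain \<Lambda>) \<and>
     (\<exists>g. angular_image \<Lambda> \<psi> g \<and>
       (\<lambda>x. radial_op \<psi> x + g x / complex_of_real ((norm x)\<^sup>2)) \<in> L2 lborel)}"

text \<open>The first-order operator applied to \<open>\<psi>\<close>, where \<open>g\<close> is a version of \<open>\<Lambda>\<^sup>1\<^sup>/\<^sup>2 \<psi>\<close>.\<close>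

definition first_order_op ::
  "('a::euclidean_space \<Rightarrow> complex) \<Rightarrow> ('a \<Rightarrow> complex) \<Rightarrow> 'a \<Rightarrow> real" where
  "first_order_op g \<psi> x = (cmod (radial_deriv \<psi> x))\<^sup>2 + (cmod (g x))\<^sup>2 / (norm x)\<^sup>2"

text \<open>\<open>Least\<close> is the minimum of a possibly infinite set (unlike \<open>Min\<close>); it is attained here because
  the \<open>lam m\<close> accumulate only at infinity.\<close>

definition hardy_const :: "real \<Rightarrow> real \<Rightarrow> 'i set \<Rightarrow> ('i \<Rightarrow> real) \<Rightarrow> real" where
  "hardy_const d \<beta> I lam = (LEAST c. c \<in> (\<lambda>m. lam m + ((d - \<beta> - 2) / 2)\<^sup>2) ` I)"

end

theory Submission
  imports Defs
begin

text \<open>In polar coordinates the inequality splits into two parts. Along every ray it is the weighted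
  one-dimensional Hardy inequality, which results from expanding the square
  \<open>|\<phi>' + (a / (2 r)) \<phi>|\<^sup>2\<close> with \<open>a = d - \<beta> - 2\<close> and integrating the cross term by parts. On every
  sphere it says that the form of \<open>\<Lambda>\<close> is bounded below by the bottom of its spectrum. As
  \<open>\<psi>(r, \<cdot>)\<close> lies in the domain of \<open>\<Lambda>\<close> itself, neither the eigenfunction expansion nor
  the functional calculus is needed for this: if the best lower bound \<open>m\<close> of the form were in the
  resolvent set, the bounded inverse of \<open>\<Lambda> - m\<close> would improve it.\<close>

section \<open>Lower bounds of self-adjoint operators\<close>

lemma borel_measurable_cnj [measurable]:
  "f \<in> borel_measurable M \<Longrightarrow> (\<lambda>x. cnj (f x)) \<in> borel_measurable M"
  by (rule measurable_compose[OF _ borel_measurable_continuous_onI]) (auto intro: continuous_intros)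

lemma L2_integrable_mult_cnj:
  assumes "f \<in> L2 M" "g \<in> L2 M"
  shows "integrable M (\<lambda>x. f x * cnj (g x))"
proof (rule Bochner_Integration.integrable_bound)
  show "integrable M (\<lambda>x. (cmod (f x))\<^sup>2 + (cmod (g x))\<^sup>2)"
    using assms by (auto simp: L2_def)
  have [measurable]: "f \<in> borel_measurable M" "g \<in> borel_measurable M"
    using assms by (auto simp: L2_def)
  show "(\<lambda>x. f x * cnj (g x)) \<in> borel_measurable M" by measurable
  show "AE x in M. norm (f x * cnj (g x)) \<le> norm ((cmod (f x))\<^sup>2 + (cmod (g x))\<^sup>2)"
  proof (rule AE_I2)
    fix x
    have "2 * (cmod (f x) * cmod (g x)) \<le> (cmod (f x))\<^sup>2 + (cmod (g x))\<^sup>2"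
      using sum_squares_bound[of "cmod (f x)" "cmod (g x)"] by (simp add: mult.assoc)
    moreover have "0 \<le> cmod (f x) * cmod (g x)" by simp
    ultimately have "cmod (f x) * cmod (g x) \<le> (cmod (f x))\<^sup>2 + (cmod (g x))\<^sup>2" by linarith
    then show "norm (f x * cnj (g x)) \<le> norm ((cmod (f x))\<^sup>2 + (cmod (g x))\<^sup>2)"
      by (simp add: norm_mult)
  qed
qed

lemma L2_cmult:
  assumes "f \<in> L2 M"
  shows "(\<lambda>x. z * f x) \<in> L2 M"
  using assms by (auto simp: L2_def norm_mult power_mult_distrib)

lemma L2_add:
  assumes "f \<in> L2 M" "g \<in> L2 M"
  shows "(\<lambda>x. f x + g x) \<in> L2 M"
proof -
  have [measurable]: "f \<in> borel_measurable M" "g \<in> borel_measurable M"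
    using assms by (auto simp: L2_def)
  \<comment> \<open>Expanding the square reduces closure under addition to integrability of the
    cross term.\<close>
  have eq: "(cmod (f x + g x))\<^sup>2 = (cmod (f x))\<^sup>2 + (cmod (g x))\<^sup>2 + 2 * Re (f x * cnj (g x))" for x
    by (simp only: cmod_power2) (simp add: power2_eq_square algebra_simps)
  have "integrable M (\<lambda>x. (cmod (f x))\<^sup>2 + (cmod (g x))\<^sup>2 + 2 * Re (f x * cnj (g x)))"
    using assms L2_integrable_mult_cnj[OF assms]
    by (intro Bochner_Integration.integrable_add integrable_mult_right integrable_Re)
       (auto simp: L2_def)
  then show ?thesis
    by (simp add: L2_def eq)
qed

lemma l2_norm_power2: "(l2_norm M f)\<^sup>2 = (LINT x|M. (cmod (f x))\<^sup>2)"
  by (simp add: l2_norm_def)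

lemma l2_inner_self: "l2_inner M f f = complex_of_real ((l2_norm M f)\<^sup>2)"
  unfolding l2_norm_power2 l2_inner_def
  by (simp only: complex_norm_square[symmetric] integral_complex_of_real)

lemma l2_inner_commute: "l2_inner M g f = cnj (l2_inner M f g)"
  unfolding l2_inner_def Bochner_Integration.integral_cnj[symmetric]
  by (simp add: mult.commute)

lemma l2_inner_add_left:
  assumes "f \<in> L2 M" "g \<in> L2 M" "h \<in> L2 M"
  shows "l2_inner M (\<lambda>x. f x + z * g x) h = l2_inner M f h + z * l2_inner M g h"
proof -
  have "l2_inner M (\<lambda>x. f x + z * g x) h = (LINT x|M. f x * cnj (h x) + z * (g x * cnj (h x)))"
    by (simp add: l2_inner_def algebra_simps)
  also have "\<dots> = l2_inner M f h + z * l2_inner M g h"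
    using assms by (simp add: l2_inner_def L2_integrable_mult_cnj)
  finally show ?thesis .
qed

lemma l2_inner_add_right:
  assumes "f \<in> L2 M" "g \<in> L2 M" "h \<in> L2 M"
  shows "l2_inner M h (\<lambda>x. f x + z * g x) = l2_inner M h f + cnj z * l2_inner M h g"
  by (subst (1 2 3) l2_inner_commute) (simp add: l2_inner_add_left assms)

lemma l2_inner_cong_AE:
  assumes "AE x in M. f x = f' x" "f \<in> L2 M" "f' \<in> L2 M" "h \<in> L2 M"
  shows "l2_inner M f h = l2_inner M f' h"
  unfolding l2_inner_def using assms
  by (intro integral_cong_AE borel_measurable_times borel_measurable_cnj) (auto simp: L2_def)

text \<open>A weighted Young inequality in the role of Cauchy-Schwarz, obtained by integrating
  \<open>0 \<le> (s |f| - |g|)^2 / s\<close>. The free weight \<open>s\<close> is matched to the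
  resolvent bound in one application and is 1 in the comparison of two square-root images.\<close>

lemma Re_l2_inner_le:
  assumes "f \<in> L2 M" "g \<in> L2 M" "s > 0"
  shows "2 * Re (l2_inner M f g) \<le> s * (l2_norm M f)\<^sup>2 + (l2_norm M g)\<^sup>2 / s"
proof -
  have pt: "2 * Re (f x * cnj (g x)) \<le> s * (cmod (f x))\<^sup>2 + (cmod (g x))\<^sup>2 / s" for x
  proof -
    have "0 \<le> (s * cmod (f x) - cmod (g x))\<^sup>2 / s" using \<open>s > 0\<close> by simp
    also have "\<dots> = s * (cmod (f x))\<^sup>2 + (cmod (g x))\<^sup>2 / s - 2 * (cmod (f x) * cmod (g x))"
      using \<open>s > 0\<close> by (simp add: field_simps power2_eq_square)
    finally have "2 * (cmod (f x) * cmod (g x)) \<le> s * (cmod (f x))\<^sup>2 + (cmod (g x))\<^sup>2 / s" by simp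
    moreover have "Re (f x * cnj (g x)) \<le> cmod (f x) * cmod (g x)"
      by (metis complex_Re_le_cmod complex_mod_cnj norm_mult)
    ultimately show ?thesis by linarith
  qed
  have "2 * Re (l2_inner M f g) = (LINT x|M. 2 * Re (f x * cnj (g x)))"
    unfolding l2_inner_def using L2_integrable_mult_cnj[OF assms(1,2)]
    by (simp del: times_complex.sel add: integral_Re)
  also have "\<dots> \<le> (LINT x|M. s * (cmod (f x))\<^sup>2 + (cmod (g x))\<^sup>2 / s)"
    using L2_integrable_mult_cnj[OF assms(1,2)] assms
    by (intro integral_mono pt Bochner_Integration.integrable_add integrable_mult_right
        integrable_Re integrable_divide) (auto simp: L2_def)
  also have "\<dots> = s * (l2_norm M f)\<^sup>2 + (l2_norm M g)\<^sup>2 / s"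
    unfolding l2_norm_power2 using assms by (simp add: L2_def)
  finally show ?thesis .
qed

section \<open>Self-adjoint operators given by their graphs\<close>

lemma self_adjoint_op_L2:
  assumes "self_adjoint_op M T" "(f, k) \<in> T"
  shows "f \<in> L2 M" "k \<in> L2 M"
  using assms unfolding self_adjoint_op_def adjoint_op_def by blast+

lemma self_adjoint_op_symmetric:
  assumes "self_adjoint_op M T" "(f, k) \<in> T" "(f', k') \<in> T"
  shows "l2_inner M k f' = l2_inner M f k'"
  using assms unfolding self_adjoint_op_def adjoint_op_def by blast

text \<open>Linearity is not built into the graph encoding. It holds because \<open>T\<close> equals
  its adjoint, and the identities defining membership in an adjoint are preserved by linear
  combinations of pairs.\<close>

lemma self_adjoint_op_add:
  assumes sa: "self_adjoint_op M T" and T: "(f, k) \<in> T" "(f', k') \<in> T"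
  shows "(\<lambda>x. f x + z * f' x, \<lambda>x. k x + z * k' x) \<in> T"
proof -
  note L = self_adjoint_op_L2[OF sa]
  have "(\<lambda>x. f x + z * f' x, \<lambda>x. k x + z * k' x) \<in> adjoint_op M T"
    unfolding adjoint_op_def
    using L[OF T(1)] L[OF T(2)] self_adjoint_op_symmetric[OF sa] T
    by (auto intro!: L2_add L2_cmult simp: l2_inner_add_right L)
  then show ?thesis using sa by (simp add: self_adjoint_op_def)
qed

text \<open>Applying the lower bound \<open>m\<close> to \<open>h - t R h\<close> with \<open>R = (T - m)\<inverse>\<close> and \<open>t = 1 / C\<close>
  improves it to \<open>m + 1 / C\<close>, where \<open>C\<close> bounds the norm of \<open>R\<close>.\<close>

lemma resolvent_improves_lower_bound:
  fixes M :: "'a measure"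
  assumes sa: "self_adjoint_op M T"
    and lb: "\<And>f k. (f, k) \<in> T \<Longrightarrow> m * (l2_norm M f)\<^sup>2 \<le> Re (l2_inner M k f)"
    and res: "complex_of_real m \<in> resolvent_set_op M T"
  obtains e where "e > 0"
    "\<And>f k. (f, k) \<in> T \<Longrightarrow> (m + e) * (l2_norm M f)\<^sup>2 \<le> Re (l2_inner M k f)"
proof -
  have surj: "\<forall>h \<in> L2 M. \<exists>(f, k) \<in> T. AE x in M. k x - complex_of_real m * f x = h x"
    and "\<exists>C. \<forall>(f, k) \<in> T. l2_norm M f \<le> C * l2_norm M (\<lambda>x. k x - complex_of_real m * f x)"
    using res unfolding resolvent_set_op_def by simp_all
  then obtain C0 where C0: "\<forall>(f, k) \<in> T. l2_norm M f \<le> C0 * l2_norm M (\<lambda>x. k x - complex_of_real m * f x)"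
    by (elim exE)
  \<comment> \<open>\<open>C0\<close> may be zero or negative. As norms are nonnegative, it can be
    enlarged to a positive bound, by which one can divide.\<close>
  define C where "C = max C0 1"
  have "C > 0" by (simp add: C_def)
  have "(m + 1 / C) * (l2_norm M h)\<^sup>2 \<le> Re (l2_inner M k h)" if hk: "(h, k) \<in> T" for h k
  proof -
    note L = self_adjoint_op_L2[OF sa]
    \<comment> \<open>Here \<open>w\<close> stands for \<open>R h\<close> and \<open>v\<close> for
      its image under \<open>T\<close>. Since \<open>v = h + m w\<close> almost everywhere, the
      inner products among \<open>h\<close>, \<open>v\<close>, \<open>w\<close> that are needed
      reduce to \<open>N\<close>, \<open>W\<close> and \<open>q\<close>.\<close>
    obtain w v :: "'a \<Rightarrow> complex" where wv: "(w, v) \<in> T" and ae: "AE x in M. v x - complex_of_real m * w x = h x"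
      using bspec[OF surj L(1)[OF hk]] by auto
    note Ls = L[OF hk] L[OF wv]
    define N where "N = (l2_norm M h)\<^sup>2"
    define W where "W = (l2_norm M w)\<^sup>2"
    define q where "q = Re (l2_inner M h w)"
    have [measurable]: "h \<in> borel_measurable M" "v \<in> borel_measurable M" "w \<in> borel_measurable M"
      using Ls by (auto simp: L2_def)
    have nh: "l2_norm M (\<lambda>x. v x - complex_of_real m * w x) = l2_norm M h"
      unfolding l2_norm_def
      by (intro arg_cong[where f = sqrt] integral_cong_AE) (use ae in auto)
    have "l2_norm M w \<le> C0 * l2_norm M h" using bspec[OF C0 wv] by (simp add: nh)
    also have "\<dots> \<le> C * l2_norm M h"
      by (intro mult_right_mono) (auto simp: C_def l2_norm_def)
    finally have "(l2_norm M w)\<^sup>2 \<le> (C * l2_norm M h)\<^sup>2"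
      by (intro power_mono) (auto simp: l2_norm_def)
    then have "W \<le> C\<^sup>2 * N" by (simp add: W_def N_def power_mult_distrib)
    \<comment> \<open>The Young inequality with weight \<open>C\<close> now gives
      \<open>2 q \<le> C N + W / C \<le> 2 C N\<close>.\<close>
    then have "W / C \<le> C * N" using \<open>C > 0\<close> by (simp add: field_simps power2_eq_square)
    then have q: "q \<le> C * N"
      using Re_l2_inner_le[OF Ls(1,3) \<open>C > 0\<close>] unfolding q_def N_def W_def by linarith
    have aev: "AE x in M. v x = h x + complex_of_real m * w x" using ae by (auto simp: algebra_simps)
    have hw: "(\<lambda>x. h x + complex_of_real m * w x) \<in> L2 M" by (intro L2_add L2_cmult Ls)
    have vh: "Re (l2_inner M v h) = N + m * q"
      by (subst l2_inner_cong_AE[OF aev]) (use Ls hw in \<open>simp_all add: l2_inner_add_left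
          l2_inner_self N_def q_def l2_inner_commute[of M w h]\<close>)
    have vw: "Re (l2_inner M v w) = q + m * W"
      by (subst l2_inner_cong_AE[OF aev]) (use Ls hw in \<open>simp_all add: l2_inner_add_left
          l2_inner_self W_def q_def\<close>)
    \<comment> \<open>By symmetry this inner product equals that of \<open>h\<close> with
      \<open>v\<close>, the conjugate of the one in \<open>vh\<close>, so the real parts
      agree.\<close>
    have kw: "Re (l2_inner M k w) = N + m * q"
      using self_adjoint_op_symmetric[OF sa hk wv] vh by (simp add: l2_inner_commute[of M h v])
    \<comment> \<open>The test vector will yield the gain \<open>2 t N - t^2 q\<close>, which is at
      least \<open>(2 t - t^2 C) N\<close> because \<open>q \<le> C N\<close>. The choice
      \<open>t = 1 / C\<close> maximizes this bound, with value \<open>N / C\<close>.\<close>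
    define t where "t = 1 / C"
    define F where "F = (\<lambda>x. h x + complex_of_real (- t) * w x)"
    define G where "G = (\<lambda>x. k x + complex_of_real (- t) * v x)"
    have FG: "(F, G) \<in> T" unfolding F_def G_def by (rule self_adjoint_op_add[OF sa hk wv])
    note LFG = L[OF FG]
    have G: "l2_inner M G x = l2_inner M k x - t * l2_inner M v x" if "x \<in> L2 M" for x
      unfolding G_def by (subst l2_inner_add_left) (use Ls that in simp_all)
    have F: "l2_inner M F x = l2_inner M h x - t * l2_inner M w x"
      and F': "l2_inner M x F = l2_inner M x h - t * l2_inner M x w" if "x \<in> L2 M" for x
      unfolding F_def by (subst l2_inner_add_left l2_inner_add_right; use Ls that in simp)+
    have "Re (l2_inner M G F) = Re (l2_inner M k h) - t * (N + m * q) - t * (N + m * q) + t\<^sup>2 * (q + m * W)"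
      using vh vw kw LFG Ls by (simp add: F' G power2_eq_square algebra_simps)
    moreover have "(l2_norm M F)\<^sup>2 = N - 2 * t * q + t\<^sup>2 * W"
    proof -
      have "l2_inner M F F = l2_inner M h h - t * l2_inner M w h
          - t * (l2_inner M h w - t * l2_inner M w w)"
        using LFG Ls by (simp add: F F')
      from arg_cong[OF this, of Re] have "Re (l2_inner M F F) = N - 2 * t * q + t\<^sup>2 * W"
        by (simp add: l2_inner_self[of M h] l2_inner_self[of M w] N_def q_def W_def
            power2_eq_square l2_inner_commute[of M w h] algebra_simps)
      then show ?thesis by (simp add: l2_inner_self)
    qed
    ultimately have "m * (N - 2 * t * q + t\<^sup>2 * W)
        \<le> Re (l2_inner M k h) - t * (N + m * q) - t * (N + m * q) + t\<^sup>2 * (q + m * W)"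
      using lb[OF FG] by simp
    \<comment> \<open>The terms with \<open>m q\<close> and with \<open>m W\<close> are the same on
      both sides and cancel.\<close>
    then have "m * N + 2 * t * N - t\<^sup>2 * q \<le> Re (l2_inner M k h)" by (simp add: algebra_simps)
    moreover have "t\<^sup>2 * q \<le> t * N"
    proof -
      have "t\<^sup>2 * q \<le> t\<^sup>2 * (C * N)" using q by (intro mult_left_mono) auto
      also have "\<dots> = t * N" using \<open>C > 0\<close> by (simp add: t_def power2_eq_square)
      finally show ?thesis .
    qed
    ultimately show ?thesis by (simp add: N_def t_def distrib_right)
  qed
  then show thesis using that[of "1 / C"] \<open>C > 0\<close> by simp
qed

text \<open>The admissible constants \<open>b\<close> form a downward closed set containing 0. If
  \<open>c\<close> were not admissible, this set would be bounded above by \<open>c\<close> and its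
  supremum \<open>m\<close>, itself admissible, would lie below \<open>c\<close>, hence in the
  resolvent set. The improved bound \<open>m + e\<close> then contradicts the choice of
  \<open>m\<close>.\<close>

lemma spectrum_lower_bound:
  assumes sa: "self_adjoint_op M T" and nn: "nonneg_op M T"
    and c: "\<And>x. complex_of_real x \<in> spectrum_op M T \<Longrightarrow> c \<le> x"
    and fk: "(f, k) \<in> T"
  shows "c * (l2_norm M f)\<^sup>2 \<le> Re (l2_inner M k f)"
proof -
  define P where "P b \<longleftrightarrow> (\<forall>(f, k) \<in> T. b * (l2_norm M f)\<^sup>2 \<le> Re (l2_inner M k f))" for b
  have P0: "P 0" using nn by (auto simp: P_def nonneg_op_def)
  have mono: "P b" if "P b'" "b \<le> b'" for b b'
    unfolding P_def
  proof clarify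
    fix f k assume "(f, k) \<in> T"
    then have "b' * (l2_norm M f)\<^sup>2 \<le> Re (l2_inner M k f)"
      using \<open>P b'\<close> unfolding P_def by blast
    then show "b * (l2_norm M f)\<^sup>2 \<le> Re (l2_inner M k f)"
      using mult_right_mono[OF \<open>b \<le> b'\<close>, of "(l2_norm M f)\<^sup>2"] by simp
  qed
  have "P c"
  proof (rule ccontr)
    assume "\<not> P c"
    then have bdd: "bdd_above {b. P b}" using mono[of _ c] by (intro bdd_aboveI[of _ c]) (metis linear mem_Collect_eq)
    define m where "m = Sup {b. P b}"
    have "P m" unfolding P_def
    proof clarify
      fix f k assume "(f, k) \<in> T"
      \<comment> \<open>For a vector of positive norm the Rayleigh quotient is an upper bound of all
        admissible constants, hence of \<open>m\<close>. Vectors of norm 0 allow no division and are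
        covered by \<open>P 0\<close>.\<close>
      show "m * (l2_norm M f)\<^sup>2 \<le> Re (l2_inner M k f)"
      proof (cases "l2_norm M f = 0")
        case True
        then show ?thesis using P0 \<open>(f, k) \<in> T\<close> by (auto simp: P_def)
      next
        case False
        then have pos: "(l2_norm M f)\<^sup>2 > 0" by simp
        have "m \<le> Re (l2_inner M k f) / (l2_norm M f)\<^sup>2" unfolding m_def
        proof (rule cSup_least)
          show "{b. P b} \<noteq> {}" using P0 by blast
        qed (use \<open>(f, k) \<in> T\<close> pos in \<open>auto simp: P_def pos_le_divide_eq\<close>)
        then show ?thesis using pos by (simp add: field_simps)
      qed
    qed
    then have "\<not> c \<le> m" using \<open>\<not> P c\<close> mono by blast
    then have "complex_of_real m \<in> resolvent_set_op M T"
      using c[of m] by (auto simp: spectrum_op_def)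
    moreover have "m * (l2_norm M f)\<^sup>2 \<le> Re (l2_inner M k f)" if "(f, k) \<in> T" for f k
      using \<open>P m\<close> that by (auto simp: P_def)
    ultimately obtain e where "e > 0"
      and e: "\<And>f k. (f, k) \<in> T \<Longrightarrow> (m + e) * (l2_norm M f)\<^sup>2 \<le> Re (l2_inner M k f)"
      using resolvent_improves_lower_bound[OF sa, of m] by metis
    have "P (m + e)" using e by (auto simp: P_def)
    then have "m + e \<le> m" unfolding m_def by (intro cSup_upper[OF _ bdd]) (simp add: m_def)
    then show False using \<open>e > 0\<close> by simp
  qed
  then show ?thesis using fk by (auto simp: P_def)
qed

text \<open>Composition provides some image \<open>h\<close> of \<open>f\<close> under
  \<open>S\<close> that \<open>S\<close> maps on to \<open>k\<close>, while \<open>g\<close> is an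
  arbitrary image. Symmetry of \<open>S\<close> makes the inner products of \<open>h\<close> with
  \<open>h\<close> and of \<open>h\<close> with \<open>g\<close> both equal to that of
  \<open>k\<close> with \<open>f\<close>. The Young inequality then bounds the norm of
  \<open>h\<close> by that of \<open>g\<close>, without first showing that \<open>g\<close> and
  \<open>h\<close> agree almost everywhere.\<close>

lemma sqrt_op_lower_bound:
  assumes sa: "self_adjoint_op M T" and nn: "nonneg_op M T"
    and S: "nonneg_sqrt_op M T S"
    and c: "\<And>x. complex_of_real x \<in> spectrum_op M T \<Longrightarrow> c \<le> x"
    and f: "f \<in> Domain T" and fg: "(f, g) \<in> S"
  shows "c * (l2_norm M f)\<^sup>2 \<le> (l2_norm M g)\<^sup>2"
proof -
  have saS: "self_adjoint_op M S" and SS: "S O S = T" using S by (auto simp: nonneg_sqrt_op_def)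
  obtain k where fk: "(f, k) \<in> T" using f by blast
  then obtain h where h: "(f, h) \<in> S" "(h, k) \<in> S" using SS by blast
  note L = self_adjoint_op_L2[OF saS]
  have kf: "l2_inner M k f = complex_of_real ((l2_norm M h)\<^sup>2)"
    using self_adjoint_op_symmetric[OF saS h(2,1)] by (simp only: l2_inner_self)
  have "l2_inner M h g = l2_inner M k f"
    using self_adjoint_op_symmetric[OF saS h(2) fg] by simp
  then have "(l2_norm M h)\<^sup>2 \<le> (l2_norm M g)\<^sup>2"
    using Re_l2_inner_le[of h M g 1] L(2)[OF h(1)] L(2)[OF fg] kf by simp
  then show ?thesis
    using spectrum_lower_bound[OF sa nn c fk] kf by simp
qed


section \<open>Polar coordinates\<close>

lemma sgn_borel_measurable [measurable]:
  "(sgn :: 'a::euclidean_space \<Rightarrow> 'a) \<in> borel_measurable borel"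
  unfolding sgn_div_norm by measurable

lemma sets_sphere_measure:
  "sets (sphere_measure :: 'a::euclidean_space measure) = sets (restrict_space borel (sphere 0 1))"
  by (simp add: sphere_measure_def)

lemma space_sphere_measure: "space (sphere_measure :: 'a::euclidean_space measure) = sphere 0 1"
  using sets_eq_imp_space_eq[OF sets_sphere_measure] by simp

lemma nn_integral_sphere_measure:
  fixes H :: "'a::euclidean_space \<Rightarrow> ennreal"
  assumes [measurable]: "H \<in> borel_measurable borel"
  shows "(\<integral>\<^sup>+ \<omega>. H \<omega> \<partial>sphere_measure) =
    ennreal (real DIM('a)) * (\<integral>\<^sup>+ y. H (sgn y) * indicator (ball 0 1 - {0}) y \<partial>lborel)"
proof -
  have [measurable]: "sgn \<in> measurable (restrict_space lborel (ball 0 1 - {0})) (restrict_space borel (sphere 0 1 :: 'a set))"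
    by (intro measurable_restrict_space3) (auto simp: norm_sgn)
  have [measurable]: "H \<in> borel_measurable (restrict_space borel (sphere 0 1))"
    by (intro measurable_restrict_space1) simp
  show ?thesis unfolding sphere_measure_def
    by (simp add: nn_integral_scale_measure nn_integral_distr nn_integral_restrict_space)
qed

lemma nn_integral_lborel_scaleR:
  fixes f :: "'a::euclidean_space \<Rightarrow> ennreal"
  assumes [measurable]: "f \<in> borel_measurable borel" and c: "c > 0"
  shows "(\<integral>\<^sup>+ x. f x \<partial>lborel) = ennreal (c ^ DIM('a)) * (\<integral>\<^sup>+ x. f (c *\<^sub>R x) \<partial>lborel)"
  by (subst lborel_affine[of c 0]) (use c in \<open>simp_all add: nn_integral_density nn_integral_distr nn_integral_cmult\<close>)

lemma nn_integral_halfline_scale: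
  fixes f :: "real \<Rightarrow> ennreal"
  assumes [measurable]: "f \<in> borel_measurable borel" and c: "c > 0"
  shows "(\<integral>\<^sup>+ r \<in> {0<..}. f r \<partial>lborel) = ennreal c * (\<integral>\<^sup>+ r \<in> {0<..}. f (c * r) \<partial>lborel)"
  by (subst nn_integral_real_affine[where c = c and t = 0])
     (use c in \<open>auto simp: indicator_def zero_less_mult_iff intro!: nn_integral_cong arg_cong2[where f = "(*)"]\<close>)

text \<open>In the proof of polar coordinates the scaling variable \<open>s\<close> finally runs
  over \<open>s > |x|\<close>, and this is the integral left over. The antiderivative
  \<open>- 1 / (d s^d)\<close> vanishes at infinity as \<open>d > 0\<close>.\<close>

lemma nn_integral_power_tail:
  assumes "a > 0" "d > 0"
  shows "(\<integral>\<^sup>+ s \<in> {a..}. ennreal (inverse (s ^ Suc d)) \<partial>lborel) = ennreal (inverse (d * a ^ d))"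
proof -
  have "(\<integral>\<^sup>+ s \<in> {a..}. ennreal (inverse (s ^ Suc d)) \<partial>lborel)
      = ennreal (0 - (- inverse (real d * a ^ d)))"
  proof (rule nn_integral_FTC_atLeast)
    show "((\<lambda>s. - inverse (real d * s ^ d)) has_real_derivative inverse (x ^ Suc d)) (at x)"
      if "a \<le> x" for x
    proof -
      have "x \<noteq> 0" using that assms by auto
      obtain d' where d: "d = Suc d'" using assms by (cases d) auto
      show ?thesis using \<open>x \<noteq> 0\<close> unfolding d
        by (intro DERIV_cong[OF DERIV_minus[OF DERIV_inverse'[OF
              DERIV_cmult[OF DERIV_pow[of "Suc d'" x]]]]])
           (auto simp: field_simps simp del: of_nat_Suc)
    qed
    have "((\<lambda>s. - inverse (real d * s ^ d)) \<longlongrightarrow> - 0) at_top"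
      using assms by (intro tendsto_minus tendsto_inverse_0_at_top
          filterlim_tendsto_pos_mult_at_top[OF tendsto_const] filterlim_pow_at_top filterlim_ident) auto
    then show "((\<lambda>s. - inverse (real d * s ^ d)) \<longlongrightarrow> 0) at_top" by simp
  qed (use assms in \<open>auto\<close>)
  then show ?thesis by simp
qed

text \<open>With the sphere integral written as an integral over the unit ball, the substitutions
  \<open>r = s |y|\<close> and \<open>x = s y\<close> reduce polar coordinates to Tonelli's theorem.\<close>

lemma nn_integral_polar:
  fixes F :: "'a::euclidean_space \<Rightarrow> ennreal"
  assumes [measurable]: "F \<in> borel_measurable borel"
  shows "(\<integral>\<^sup>+ \<omega>. (\<integral>\<^sup>+ r \<in> {0<..}. ennreal (r ^ (DIM('a) - 1)) * F (r *\<^sub>R \<omega>) \<partial>lborel) \<partial>sphere_measure)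
    = (\<integral>\<^sup>+ x. F x \<partial>lborel)"
proof -
  define d where "d = DIM('a)"
  have d: "d > 0" by (simp add: d_def)
  have dS: "c ^ (d - 1) * c = c ^ d" for c :: real using d by (cases d) auto
  define B where "B = (ball 0 1 - {0} :: 'a set)"
  have [measurable]: "B \<in> sets borel" by (simp add: B_def)
  have shuffle: "a * (p * f * (i * (q * j))) = a * (p * q) * (f * (i * j))" for a p f i q j :: ennreal
    by (simp add: mult_ac)
  \<comment> \<open>The substitution \<open>r = s |y|\<close>: its Jacobian \<open>|y|\<close> and
    the factor \<open>|y|^(d - 1)\<close> from the radial density combine to
    \<open>|y|^d\<close>.\<close>
  have rad: "(\<integral>\<^sup>+ r \<in> {0<..}. ennreal (r ^ (d - 1)) * F (r *\<^sub>R sgn y) \<partial>lborel) * indicator B y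
     = (\<integral>\<^sup>+ s. (ennreal (s ^ (d - 1)) * indicator {0<..} s) * (ennreal (norm y ^ d) * F (s *\<^sub>R y) * indicator B y) \<partial>lborel)"
    (is "?l = ?r") for y :: 'a
  proof (cases "y \<in> B")
    case True
    then have y: "norm y > 0" by (simp add: B_def)
    have "?l = (\<integral>\<^sup>+ r \<in> {0<..}. ennreal (r ^ (d - 1)) * F (r *\<^sub>R sgn y) \<partial>lborel)"
      using True by simp
    also have "\<dots> = (\<integral>\<^sup>+ s. ennreal (norm y) * (ennreal ((norm y * s) ^ (d - 1)) * F ((norm y * s) *\<^sub>R sgn y) * indicator {0<..} s) \<partial>lborel)"
      by (subst nn_integral_halfline_scale[OF _ y]) (simp_all add: nn_integral_cmult)
    also have "\<dots> = ?r"
    proof (intro nn_integral_cong)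
      fix s :: real
      show "ennreal (norm y) * (ennreal ((norm y * s) ^ (d - 1)) * F ((norm y * s) *\<^sub>R sgn y) * indicator {0<..} s)
        = (ennreal (s ^ (d - 1)) * indicator {0<..} s) * (ennreal (norm y ^ d) * F (s *\<^sub>R y) * indicator B y)"
      proof (cases "s > 0")
        case s: True
        have "(norm y * s) *\<^sub>R sgn y = s *\<^sub>R y" using y by (simp add: sgn_div_norm)
        moreover have "ennreal (norm y) * ennreal ((norm y * s) ^ (d - 1)) = ennreal (s ^ (d - 1)) * ennreal (norm y ^ d)"
          using s y by (simp add: power_mult_distrib dS[symmetric] mult_ac flip: ennreal_mult)
        ultimately have "ennreal (norm y) * (ennreal ((norm y * s) ^ (d - 1)) * F ((norm y * s) *\<^sub>R sgn y))
            = ennreal (s ^ (d - 1)) * (ennreal (norm y ^ d) * F (s *\<^sub>R y))"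
          by (simp only: mult.assoc[symmetric])
        then show ?thesis using s True by simp
      qed simp
    qed
    finally show ?thesis .
  qed simp
  have "(\<integral>\<^sup>+ \<omega>. (\<integral>\<^sup>+ r \<in> {0<..}. ennreal (r ^ (d - 1)) * F (r *\<^sub>R \<omega>) \<partial>lborel) \<partial>sphere_measure)
     = ennreal d * (\<integral>\<^sup>+ y. (\<integral>\<^sup>+ r \<in> {0<..}. ennreal (r ^ (d - 1)) * F (r *\<^sub>R sgn y) \<partial>lborel) * indicator B y \<partial>lborel)"
    unfolding d_def B_def by (rule nn_integral_sphere_measure) measurable
  also have "(\<integral>\<^sup>+ y. (\<integral>\<^sup>+ r \<in> {0<..}. ennreal (r ^ (d - 1)) * F (r *\<^sub>R sgn y) \<partial>lborel) * indicator B y \<partial>lborel)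
     = (\<integral>\<^sup>+ s. (\<integral>\<^sup>+ y. (ennreal (s ^ (d - 1)) * indicator {0<..} s) * (ennreal (norm y ^ d) * F (s *\<^sub>R y) * indicator B y) \<partial>lborel) \<partial>lborel)"
    unfolding rad by (rule lborel_pair.Fubini') measurable
  \<comment> \<open>The substitution \<open>x = s y\<close> for fixed \<open>s\<close>:
    \<open>|y|^d = |x|^d / s^d\<close> and \<open>dy = s^(-d) dx\<close>, so that
    \<open>s^(d - 1)\<close> turns into \<open>s^(- d - 1)\<close>. The unit ball condition on
    \<open>y\<close> becomes \<open>|x| < s\<close>.\<close>
  also have "\<dots> = (\<integral>\<^sup>+ s. (\<integral>\<^sup>+ x. ennreal (norm x ^ d) * F x * (indicator (- {0}) x * (ennreal (inverse (s ^ Suc d)) * indicator {norm x<..} s)) \<partial>lborel) \<partial>lborel)"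
  proof (rule nn_integral_cong)
    fix s :: real
    show "(\<integral>\<^sup>+ y. (ennreal (s ^ (d - 1)) * indicator {0<..} s) * (ennreal (norm y ^ d) * F (s *\<^sub>R y) * indicator B y) \<partial>lborel)
      = (\<integral>\<^sup>+ x. ennreal (norm x ^ d) * F x * (indicator (- {0}) x * (ennreal (inverse (s ^ Suc d)) * indicator {norm x<..} s)) \<partial>lborel)"
    proof (cases "s > 0")
      case s: True
      define f where "f x = ennreal (norm x ^ d) * F x * (indicator (- {0}) x * (ennreal (inverse (s ^ Suc d)) * indicator {norm x<..} s))" for x :: 'a
      have f [measurable]: "f \<in> borel_measurable borel"
        unfolding f_def indicator_def greaterThan_iff of_bool_def by measurable
      have "(\<integral>\<^sup>+ x. f x \<partial>lborel) = (\<integral>\<^sup>+ y. ennreal (s ^ d) * f (s *\<^sub>R y) \<partial>lborel)"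
        unfolding d_def nn_integral_lborel_scaleR[OF f s] by (rule nn_integral_cmult[symmetric]) measurable
      also have "\<dots> = (\<integral>\<^sup>+ y. (ennreal (s ^ (d - 1)) * indicator {0<..} s) * (ennreal (norm y ^ d) * F (s *\<^sub>R y) * indicator B y) \<partial>lborel)"
      proof (intro nn_integral_cong)
        fix y :: 'a
        have i: "indicator (- {0}) (s *\<^sub>R y) * indicator {norm (s *\<^sub>R y)<..} s = (indicator B y :: ennreal)"
          using s by (auto simp: B_def indicator_def)
        have "s ^ d * (norm (s *\<^sub>R y) ^ d * inverse (s ^ Suc d)) = s ^ (d - 1) * norm y ^ d"
          using s by (simp add: power_mult_distrib dS[symmetric] field_simps)
        then have "ennreal (s ^ d) * (ennreal (norm (s *\<^sub>R y) ^ d) * ennreal (inverse (s ^ Suc d))) = ennreal (s ^ (d - 1)) * ennreal (norm y ^ d)"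
          using s by (simp only: ennreal_mult[symmetric] zero_le_power norm_ge_zero mult_nonneg_nonneg
              inverse_nonnegative_iff_nonnegative less_imp_le)
        then have "ennreal (s ^ d) * f (s *\<^sub>R y)
            = ennreal (s ^ (d - 1)) * ennreal (norm y ^ d) * (F (s *\<^sub>R y) * indicator B y)"
          by (simp only: f_def shuffle i)
        then show "ennreal (s ^ d) * f (s *\<^sub>R y)
            = (ennreal (s ^ (d - 1)) * indicator {0<..} s) * (ennreal (norm y ^ d) * F (s *\<^sub>R y) * indicator B y)"
          using s by (simp add: mult.assoc)
      qed
      finally show ?thesis unfolding f_def by (rule sym)
    next
      case False
      \<comment> \<open>The condition \<open>|x| < s\<close> already contains \<open>s > 0\<close>,
        so both sides vanish here.\<close>
      then have "s \<notin> {norm x<..}" for x :: 'a using norm_ge_zero[of x] by (simp del: norm_ge_zero)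
      then show ?thesis using False by simp
    qed
  qed
  also have "\<dots> = (\<integral>\<^sup>+ x. (\<integral>\<^sup>+ s. ennreal (norm x ^ d) * F x * (indicator (- {0}) x * (ennreal (inverse (s ^ Suc d)) * indicator {norm x<..} s)) \<partial>lborel) \<partial>lborel)"
    \<comment> \<open>The set in \<open>indicator {norm x<..} s\<close> depends on the other
      variable. Unfolded, it is a measurable condition on the pair.\<close>
    by (rule lborel_pair.Fubini') (unfold indicator_def greaterThan_iff of_bool_def, measurable)
  also have "\<dots> = (\<integral>\<^sup>+ x. F x * ennreal (inverse d) \<partial>lborel)"
  proof (rule nn_integral_cong_AE)
    have "AE x in lborel. (x :: 'a) \<noteq> 0" by (rule AE_lborel_singleton)
    then show "AE x in lborel. (\<integral>\<^sup>+ s. ennreal (norm x ^ d) * F x * (indicator (- {0}) x * (ennreal (inverse (s ^ Suc d)) * indicator {norm x<..} s)) \<partial>lborel)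
        = F x * ennreal (inverse d)"
    proof eventually_elim
      case (elim x)
      then have x: "norm x > 0" by simp
      have "(\<integral>\<^sup>+ s. ennreal (norm x ^ d) * F x * (indicator (- {0}) x * (ennreal (inverse (s ^ Suc d)) * indicator {norm x<..} s)) \<partial>lborel)
        = ennreal (norm x ^ d) * F x * (\<integral>\<^sup>+ s \<in> {norm x<..}. ennreal (inverse (s ^ Suc d)) \<partial>lborel)"
        using elim by (simp add: nn_integral_cmult)
      also have "(\<integral>\<^sup>+ s \<in> {norm x<..}. ennreal (inverse (s ^ Suc d)) \<partial>lborel) = (\<integral>\<^sup>+ s \<in> {norm x..}. ennreal (inverse (s ^ Suc d)) \<partial>lborel)"
        by (intro nn_integral_cong_AE eventually_mono[OF AE_lborel_singleton[of "norm x"]])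
           (auto simp: indicator_def)
      also have "\<dots> = ennreal (inverse (d * norm x ^ d))" by (rule nn_integral_power_tail[OF x d])
      also have "ennreal (norm x ^ d) * F x * ennreal (inverse (d * norm x ^ d)) = F x * (ennreal (norm x ^ d) * ennreal (inverse (d * norm x ^ d)))"
        by (simp add: mult_ac)
      also have "ennreal (norm x ^ d) * ennreal (inverse (d * norm x ^ d)) = ennreal (inverse d)"
        using x d by (subst ennreal_mult[symmetric]) (auto simp: field_simps)
      finally show ?case .
    qed
  qed
  \<comment> \<open>The factor \<open>1 / d\<close> from the tail integral cancels the factor
    \<open>d\<close> in \<open>sphere_measure\<close>.\<close>
  also have "ennreal d * (\<integral>\<^sup>+ x. F x * ennreal (inverse d) \<partial>lborel) = (ennreal d * ennreal (inverse d)) * (\<integral>\<^sup>+ x. F x \<partial>lborel)"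
    by (simp add: nn_integral_multc mult_ac)
  also have "ennreal d * ennreal (inverse d) = 1"
    using d by (subst ennreal_mult[symmetric]) auto
  finally show ?thesis by (simp add: d_def)
qed

text \<open>The sphere measure enters only through an integral over the unit ball, so that
  exchanging the order of integration needs no product with the sphere measure.\<close>

lemma nn_integral_polar':
  fixes F :: "'a::euclidean_space \<Rightarrow> ennreal"
  assumes [measurable]: "F \<in> borel_measurable borel"
  shows "(\<integral>\<^sup>+ r \<in> {0<..}. ennreal (r ^ (DIM('a) - 1)) * (\<integral>\<^sup>+ \<omega>. F (r *\<^sub>R \<omega>) \<partial>sphere_measure) \<partial>lborel)
    = (\<integral>\<^sup>+ x. F x \<partial>lborel)"
proof -
  let ?d = "ennreal (real DIM('a))"
  let ?p = "\<lambda>r::real. ennreal (r ^ (DIM('a) - 1))"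
  let ?B = "ball 0 1 - {0} :: 'a set"
  have [measurable]: "?B \<in> sets borel" by simp
  have "(\<integral>\<^sup>+ x. F x \<partial>lborel) = ?d * (\<integral>\<^sup>+ y. (\<integral>\<^sup>+ r \<in> {0<..}. ?p r * F (r *\<^sub>R sgn y) \<partial>lborel) * indicator ?B y \<partial>lborel)"
    unfolding nn_integral_polar[OF assms, symmetric] by (rule nn_integral_sphere_measure) measurable
  also have "(\<integral>\<^sup>+ y. (\<integral>\<^sup>+ r \<in> {0<..}. ?p r * F (r *\<^sub>R sgn y) \<partial>lborel) * indicator ?B y \<partial>lborel)
    = (\<integral>\<^sup>+ y. (\<integral>\<^sup>+ r. ?p r * indicator {0<..} r * (F (r *\<^sub>R sgn y) * indicator ?B y) \<partial>lborel) \<partial>lborel)"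
    by (subst nn_integral_multc[symmetric]) (auto intro!: nn_integral_cong simp: mult_ac)
  also have "\<dots> = (\<integral>\<^sup>+ r. (\<integral>\<^sup>+ y. ?p r * indicator {0<..} r * (F (r *\<^sub>R sgn y) * indicator ?B y) \<partial>lborel) \<partial>lborel)"
    by (rule lborel_pair.Fubini') measurable
  also have "\<dots> = (\<integral>\<^sup>+ r. ?p r * indicator {0<..} r * (\<integral>\<^sup>+ y. F (r *\<^sub>R sgn y) * indicator ?B y \<partial>lborel) \<partial>lborel)"
    by (intro nn_integral_cong nn_integral_cmult) measurable
  also have "?d * \<dots> = (\<integral>\<^sup>+ r. ?p r * indicator {0<..} r * (?d * (\<integral>\<^sup>+ y. F (r *\<^sub>R sgn y) * indicator ?B y \<partial>lborel)) \<partial>lborel)"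
    by (subst nn_integral_cmult[symmetric]) (auto intro!: nn_integral_cong simp: mult_ac)
  also have "\<dots> = (\<integral>\<^sup>+ r \<in> {0<..}. ?p r * (\<integral>\<^sup>+ \<omega>. F (r *\<^sub>R \<omega>) \<partial>sphere_measure) \<partial>lborel)"
    by (subst nn_integral_sphere_measure) (auto intro!: nn_integral_cong simp: mult_ac)
  finally show ?thesis ..
qed


section \<open>The radial Hardy inequality\<close>

text \<open>As \<open>\<phi>\<close> vanishes near 0 and for large \<open>s\<close>, everything
  takes place on the compact interval \<open>{e..R}\<close>, where the powers of \<open>s\<close>
  are smooth and the boundary terms of \<open>F\<close> are zero. This is why \<open>a\<close> may
  have either sign.\<close>

lemma weighted_Hardy_halfline:
  fixes \<phi> \<phi>' :: "real \<Rightarrow> complex"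
  assumes der: "\<And>s. (\<phi> has_vector_derivative \<phi>' s) (at s)"
    and cont: "continuous_on UNIV \<phi>'"
    and e: "0 < e" "e \<le> R"
    and zero: "\<And>s. 0 \<le> s \<Longrightarrow> s \<le> e \<Longrightarrow> \<phi> s = 0" "\<And>s. R \<le> s \<Longrightarrow> \<phi> s = 0"
  shows "ennreal ((a / 2)\<^sup>2) * (\<integral>\<^sup>+ s \<in> {0<..}. ennreal ((cmod (\<phi> s))\<^sup>2 * s powr (a - 1)) \<partial>lborel)
    \<le> (\<integral>\<^sup>+ s \<in> {0<..}. ennreal ((cmod (\<phi>' s))\<^sup>2 * s powr (a + 1)) \<partial>lborel)"
proof -
  have c\<phi>: "continuous_on A \<phi>" for A
    using der by (meson continuous_at_imp_continuous_on has_vector_derivative_continuous)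
  have c\<phi>': "continuous_on A \<phi>'" for A using cont continuous_on_subset by blast
  \<comment> \<open>On complex numbers \<open>\<bullet>\<close> is the real inner product, so
    \<open>F\<close> is the real function \<open>|\<phi>|^2 s^a\<close>.\<close>
  define F where "F s = (\<phi> s \<bullet> \<phi> s) * s powr a" for s
  define F' where "F' s = 2 * (\<phi> s \<bullet> \<phi>' s) * s powr a + (\<phi> s \<bullet> \<phi> s) * (a * s powr (a - 1))" for s
  define A where "A s = (cmod (\<phi> s))\<^sup>2 * s powr (a - 1)" for s
  define B where "B s = (cmod (\<phi>' s))\<^sup>2 * s powr (a + 1)" for s
  have FF': "DERIV F s :> F' s" if "s > 0" for s
  proof -
    have "((\<lambda>s. \<phi> s \<bullet> \<phi> s) has_real_derivative 2 * (\<phi> s \<bullet> \<phi>' s)) (at s)"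
      unfolding has_real_derivative_iff_has_vector_derivative has_vector_derivative_def
      using der[of s, unfolded has_vector_derivative_def]
      by (auto intro!: derivative_eq_intros simp: inner_commute algebra_simps)
    moreover have "((\<lambda>s. s powr a) has_real_derivative a * s powr (a - 1)) (at s)"
      using that by (auto intro!: derivative_eq_intros)
    ultimately show ?thesis unfolding F_def F'_def
      by (rule DERIV_cong[OF DERIV_mult]) simp
  qed
  have pos: "s > 0" if "s \<in> {e..R}" for s using that e by auto
  have cF': "continuous_on {e..R} F'" and cA: "continuous_on {e..R} A" and cB: "continuous_on {e..R} B"
    unfolding F'_def A_def B_def using e
    by (auto intro!: continuous_intros c\<phi> c\<phi>')
  note bi = borel_integrable_atLeastAtMost'[unfolded set_integrable_def]
  have "(LBINT s:{e..R}. F' s) = F R - F e"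
    unfolding set_lebesgue_integral_def
  proof (subst integral_FTC_Icc[of e R F F'])
    show "(F has_vector_derivative F' x) (at x within {e..R})" if "e \<le> x" "x \<le> R" for x
      using FF'[of x] that e
      by (auto simp: has_real_derivative_iff_has_vector_derivative
          intro: has_vector_derivative_at_within)
  qed (use e cF' in auto)
  then have I0: "(LBINT s:{e..R}. F' s) = 0" using zero e by (simp add: F_def)
  have pt: "(a / 2)\<^sup>2 * A s - (a / 2) * F' s \<le> B s" if "s \<in> {e..R}" for s
  proof -
    have s: "s > 0" using pos that by simp
    have p: "s powr (a - 1) = s powr (a + 1) / s\<^sup>2" "s powr a = s powr (a + 1) / s"
      using s by (auto simp: powr_diff powr_add power2_eq_square)
    \<comment> \<open>The square expands to \<open>B\<close>, a cross term and
      \<open>(a / 2)^2 A\<close>. Since \<open>(a / 2) F'\<close> is that cross term plus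
      \<open>2 (a / 2)^2 A\<close>, subtracting it from the square reverses the sign of the
      \<open>A\<close> term.\<close>
    have "0 \<le> (cmod (\<phi>' s + (a / (2 * s)) *\<^sub>R \<phi> s))\<^sup>2 * s powr (a + 1)" by simp
    also have "\<dots> = B s - ((a / 2)\<^sup>2 * A s - (a / 2) * F' s)"
      unfolding A_def B_def F'_def p power2_norm_eq_inner using s
      by (simp add: inner_add_left inner_add_right inner_commute power2_eq_square field_simps)
    finally show ?thesis by simp
  qed
  have iA: "set_integrable lborel {e..R} A" and iB: "set_integrable lborel {e..R} B"
    and iF': "set_integrable lborel {e..R} F'"
    by (intro borel_integrable_atLeastAtMost' cA cB cF')+
  have "(LBINT s:{e..R}. (a / 2)\<^sup>2 * A s - (a / 2) * F' s) \<le> (LBINT s:{e..R}. B s)"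
    using iA iB iF' pt by (intro set_integral_mono set_integral_diff) auto
  then have le: "(a / 2)\<^sup>2 * (LBINT s:{e..R}. A s) \<le> (LBINT s:{e..R}. B s)"
    using iA iF' I0 by (simp add: set_integral_diff)
  have nnA: "(\<integral>\<^sup>+ s \<in> {e..R}. ennreal (A s) \<partial>lborel) = ennreal (LBINT s:{e..R}. A s)"
    using iA by (subst nn_integral_set_ennreal) (auto simp: set_lebesgue_integral_def set_integrable_def A_def mult.commute intro!: nn_integral_eq_integral)
  have nnB: "(\<integral>\<^sup>+ s \<in> {e..R}. ennreal (B s) \<partial>lborel) = ennreal (LBINT s:{e..R}. B s)"
    using iB by (subst nn_integral_set_ennreal) (auto simp: set_lebesgue_integral_def set_integrable_def B_def mult.commute intro!: nn_integral_eq_integral)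
  have "(\<integral>\<^sup>+ s \<in> {0<..}. ennreal (A s) \<partial>lborel) = (\<integral>\<^sup>+ s \<in> {e..R}. ennreal (A s) \<partial>lborel)"
    using zero e by (intro nn_integral_cong) (auto simp: A_def indicator_def)
  then have "ennreal ((a / 2)\<^sup>2) * (\<integral>\<^sup>+ s \<in> {0<..}. ennreal (A s) \<partial>lborel)
      \<le> (\<integral>\<^sup>+ s \<in> {e..R}. ennreal (B s) \<partial>lborel)"
    using le by (simp add: nnA nnB ennreal_leI flip: ennreal_mult')
  also have "\<dots> \<le> (\<integral>\<^sup>+ s \<in> {0<..}. ennreal (B s) \<partial>lborel)"
    using e by (intro nn_integral_mono) (auto simp: indicator_def)
  finally show ?thesis unfolding A_def B_def .
qed

section \<open>Test functions and their derivatives along rays\<close>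

lemma test_functions_C1:
  assumes "\<psi> \<in> test_functions"
  shows "\<psi> differentiable (at x)"
    and "continuous_on UNIV \<psi>"
    and "continuous_on UNIV (\<lambda>x. frechet_derivative \<psi> (at x) v)"
proof -
  have "Ck 0 \<psi>" "Ck (Suc 0) \<psi>" using assms unfolding test_functions_def by blast+
  then show "\<psi> differentiable (at x)" "continuous_on UNIV \<psi>"
    "continuous_on UNIV (\<lambda>x. frechet_derivative \<psi> (at x) v)" by auto
qed

lemma test_functions_support:
  assumes "\<psi> \<in> test_functions"
  obtains e R where "0 < e" "e \<le> R" "\<And>x. norm x \<le> e \<Longrightarrow> \<psi> x = 0" "\<And>x. R \<le> norm x \<Longrightarrow> \<psi> x = 0"
proof -
  define S where "S = closure {x. \<psi> x \<noteq> 0}"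
  have S: "compact S" "0 \<notin> S" using assms by (auto simp: test_functions_def S_def)
  have supp: "\<psi> x = 0" if "x \<notin> S" for x
    using that closure_subset[of "{x. \<psi> x \<noteq> 0}"] by (auto simp: S_def)
  have "open (- S)" using S by (simp add: compact_imp_closed open_Compl)
  then obtain e where e: "e > 0" "cball 0 e \<subseteq> - S"
    using S(2) open_contains_cball[of "- S"] by auto
  obtain b where b: "\<And>x. x \<in> S \<Longrightarrow> norm x \<le> b"
    using compact_imp_bounded[OF S(1)] unfolding bounded_iff by auto
  show thesis
  \<comment> \<open>The maximum ensures \<open>e \<le> R\<close>. The added 1 puts points with
    \<open>|x| = R\<close> strictly outside the support.\<close>
  proof (rule that[of e "max e (b + 1)"])
    show "\<psi> x = 0" if "norm x \<le> e" for x
      using that e by (intro supp) (auto simp: subset_iff)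
    show "\<psi> x = 0" if "max e (b + 1) \<le> norm x" for x
      using that b[of x] by (intro supp) auto
  qed (use e in auto)
qed

lemma has_vector_derivative_ray:
  assumes "\<psi> differentiable (at (s *\<^sub>R \<omega>))"
  shows "((\<lambda>s. \<psi> (s *\<^sub>R \<omega>)) has_vector_derivative frechet_derivative \<psi> (at (s *\<^sub>R \<omega>)) \<omega>) (at s)"
proof -
  let ?D = "frechet_derivative \<psi> (at (s *\<^sub>R \<omega>))"
  have D: "(\<psi> has_derivative ?D) (at (s *\<^sub>R \<omega>))"
    using assms by (simp add: frechet_derivative_works)
  have "((\<lambda>s. s *\<^sub>R \<omega>) has_derivative (\<lambda>h. h *\<^sub>R \<omega>)) (at s)"
    by (auto intro!: derivative_eq_intros)
  from has_derivative_compose[OF this D] show ?thesis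
    unfolding has_vector_derivative_def
    by (simp add: linear_scale[OF has_derivative_linear[OF D]])
qed

lemma radial_deriv_eq:
  assumes "\<psi> differentiable (at x)"
  shows "radial_deriv \<psi> x = frechet_derivative \<psi> (at x) (sgn x)"
proof -
  \<comment> \<open>The origin is included because \<open>sgn 0 = 0\<close>; there the radial
    derivative is the derivative in direction 0.\<close>
  have x: "norm x *\<^sub>R sgn x = x" by (cases "x = 0") (simp_all add: sgn_div_norm)
  have "\<psi> differentiable (at (norm x *\<^sub>R sgn x))" unfolding x by (rule assms)
  from vector_derivative_at[OF has_vector_derivative_ray[OF this]] show ?thesis
    by (simp add: radial_deriv_def x)
qed

text \<open>Continuity of the derivative is available for fixed directions only, whereas the radial
  direction \<open>sgn x\<close> varies with \<open>x\<close> and jumps at the origin. Expanding it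
  in the basis separates measurable coefficients from continuous partial derivatives.\<close>

lemma radial_deriv_borel_measurable:
  assumes "\<psi> \<in> test_functions"
  shows "radial_deriv \<psi> \<in> borel_measurable borel"
proof -
  note C1 = test_functions_C1[OF assms]
  have [measurable]: "(\<lambda>x. frechet_derivative \<psi> (at x) v) \<in> borel_measurable borel" for v
    by (intro borel_measurable_continuous_onI C1)
  have "radial_deriv \<psi> = (\<lambda>x. \<Sum>b\<in>Basis. (sgn x \<bullet> b) *\<^sub>R frechet_derivative \<psi> (at x) b)"
  proof
    fix x
    have lin: "linear (frechet_derivative \<psi> (at x))" by (rule linear_frechet_derivative[OF C1(1)])
    have "radial_deriv \<psi> x = frechet_derivative \<psi> (at x) (\<Sum>b\<in>Basis. (sgn x \<bullet> b) *\<^sub>R b)"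
      by (simp add: radial_deriv_eq[OF C1(1)] euclidean_representation)
    then show "radial_deriv \<psi> x = (\<Sum>b\<in>Basis. (sgn x \<bullet> b) *\<^sub>R frechet_derivative \<psi> (at x) b)"
      by (simp add: linear_sum[OF lin] linear_scale[OF lin])
  qed
  moreover have "(\<lambda>x. \<Sum>b\<in>Basis. (sgn x \<bullet> b) *\<^sub>R frechet_derivative \<psi> (at x) b) \<in> borel_measurable borel"
    by measurable
  ultimately show ?thesis by simp
qed

text \<open>With \<open>a = d - \<beta> - 2\<close>, the density \<open>r^(d - 1)\<close> turns the
  weights \<open>|x|^(- \<beta> - 2)\<close> and \<open>|x|^(- \<beta>)\<close> into
  \<open>r^(a - 1)\<close> and \<open>r^(a + 1)\<close>, so the half-line inequality applies on each
  ray. Extended nonnegative integrals make finiteness a matter for the theorem alone.\<close>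

lemma radial_Hardy:
  fixes \<psi> :: "'a::euclidean_space \<Rightarrow> complex"
  assumes \<psi>: "\<psi> \<in> test_functions"
  shows "ennreal (((real DIM('a) - \<beta> - 2) / 2)\<^sup>2) *
      (\<integral>\<^sup>+ x. ennreal ((cmod (\<psi> x))\<^sup>2 / norm x powr (\<beta> + 2)) \<partial>lborel)
    \<le> (\<integral>\<^sup>+ x. ennreal ((cmod (radial_deriv \<psi> x))\<^sup>2 / norm x powr \<beta>) \<partial>lborel)"
proof -
  note C1 = test_functions_C1[OF \<psi>]
  have [measurable]: "\<psi> \<in> borel_measurable borel" "radial_deriv \<psi> \<in> borel_measurable borel"
    by (auto intro: borel_measurable_continuous_onI C1 radial_deriv_borel_measurable[OF \<psi>])
  define a where "a = real DIM('a) - \<beta> - 2"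
  define K where "K = ennreal ((a / 2)\<^sup>2)"
  let ?p = "\<lambda>r::real. ennreal (r ^ (DIM('a) - 1))"
  define F where "F x = ennreal ((cmod (\<psi> x))\<^sup>2 / norm x powr (\<beta> + 2))" for x
  define G where "G x = ennreal ((cmod (radial_deriv \<psi> x))\<^sup>2 / norm x powr \<beta>)" for x
  have [measurable]: "F \<in> borel_measurable borel" "G \<in> borel_measurable borel"
    unfolding F_def G_def by measurable
  obtain e R where eR: "0 < e" "e \<le> R" "\<And>x. norm x \<le> e \<Longrightarrow> \<psi> x = 0" "\<And>x. R \<le> norm x \<Longrightarrow> \<psi> x = 0"
    using test_functions_support[OF \<psi>] by blast
  have ray: "(\<integral>\<^sup>+ r \<in> {0<..}. ?p r * (K * F (r *\<^sub>R \<omega>)) \<partial>lborel) \<le> (\<integral>\<^sup>+ r \<in> {0<..}. ?p r * G (r *\<^sub>R \<omega>) \<partial>lborel)"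
    if \<omega>: "norm \<omega> = 1" for \<omega>
  proof -
    define \<phi> where "\<phi> s = \<psi> (s *\<^sub>R \<omega>)" for s
    define \<phi>' where "\<phi>' s = frechet_derivative \<psi> (at (s *\<^sub>R \<omega>)) \<omega>" for s
    \<comment> \<open>The natural number subtraction agrees with the real one because the dimension
      is positive.\<close>
    have p: "?p r = ennreal (r powr (real DIM('a) - 1))" if "r > 0" for r
      using that powr_realpow[of r "DIM('a) - 1"] by (simp add: of_nat_diff Suc_leI)
    have weight: "ennreal (r powr (real DIM('a) - 1)) * ennreal (x / r powr b) = ennreal (x * r powr (real DIM('a) - 1 - b))"
      if "r > 0" "x \<ge> 0" for r x b :: real
      using that by (simp add: powr_diff mult_ac flip: ennreal_mult)
    have "(\<integral>\<^sup>+ r \<in> {0<..}. ?p r * (K * F (r *\<^sub>R \<omega>)) \<partial>lborel)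
        = (\<integral>\<^sup>+ r. K * (?p r * F (r *\<^sub>R \<omega>) * indicator {0<..} r) \<partial>lborel)"
      by (simp add: mult_ac)
    also have "\<dots> = K * (\<integral>\<^sup>+ r \<in> {0<..}. ?p r * F (r *\<^sub>R \<omega>) \<partial>lborel)"
      by (rule nn_integral_cmult) measurable
    also have "(\<integral>\<^sup>+ r \<in> {0<..}. ?p r * F (r *\<^sub>R \<omega>) \<partial>lborel)
        = (\<integral>\<^sup>+ s \<in> {0<..}. ennreal ((cmod (\<phi> s))\<^sup>2 * s powr (a - 1)) \<partial>lborel)"
    proof (rule nn_integral_cong)
      fix r :: real
      have eq: "real DIM('a) - 1 - (\<beta> + 2) = a - 1" by (simp add: a_def)
      show "?p r * F (r *\<^sub>R \<omega>) * indicator {0<..} r = ennreal ((cmod (\<phi> r))\<^sup>2 * r powr (a - 1)) * indicator {0<..} r"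
        using weight[of r "(cmod (\<phi> r))\<^sup>2" "\<beta> + 2", unfolded eq] p[of r] \<omega>
        by (cases "r > 0") (simp_all add: F_def \<phi>_def)
    qed
    also have "K * \<dots> \<le> (\<integral>\<^sup>+ s \<in> {0<..}. ennreal ((cmod (\<phi>' s))\<^sup>2 * s powr (a + 1)) \<partial>lborel)"
      unfolding K_def
    proof (rule weighted_Hardy_halfline)
      show "(\<phi> has_vector_derivative \<phi>' s) (at s)" for s
        unfolding \<phi>_def \<phi>'_def by (rule has_vector_derivative_ray[OF C1(1)])
      show "continuous_on UNIV \<phi>'" unfolding \<phi>'_def
        by (rule continuous_on_compose2[OF C1(3)]) (auto intro!: continuous_intros)
      show "\<phi> s = 0" if "0 \<le> s" "s \<le> e" for s
        using that eR(3)[of "s *\<^sub>R \<omega>"] \<omega> by (simp add: \<phi>_def)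
      show "\<phi> s = 0" if "R \<le> s" for s
        using that eR(1,2) eR(4)[of "s *\<^sub>R \<omega>"] \<omega> by (simp add: \<phi>_def)
    qed (use eR in auto)
    also have "\<dots> = (\<integral>\<^sup>+ r \<in> {0<..}. ?p r * G (r *\<^sub>R \<omega>) \<partial>lborel)"
    proof (rule nn_integral_cong)
      fix r :: real
      have "sgn (r *\<^sub>R \<omega>) = \<omega>" if "r > 0" using that \<omega> by (simp add: sgn_div_norm)
      then have "radial_deriv \<psi> (r *\<^sub>R \<omega>) = \<phi>' r" if "r > 0"
        using that by (simp add: radial_deriv_eq[OF C1(1)] \<phi>'_def)
      moreover have eq: "real DIM('a) - 1 - \<beta> = a + 1" by (simp add: a_def)
      ultimately show "ennreal ((cmod (\<phi>' r))\<^sup>2 * r powr (a + 1)) * indicator {0<..} r = ?p r * G (r *\<^sub>R \<omega>) * indicator {0<..} r"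
        using weight[of r "(cmod (\<phi>' r))\<^sup>2" "\<beta>", unfolded eq] p[of r] \<omega>
        by (cases "r > 0") (simp_all add: G_def)
    qed
    finally show ?thesis .
  qed
  have "K * (\<integral>\<^sup>+ x. F x \<partial>lborel) = (\<integral>\<^sup>+ x. K * F x \<partial>lborel)"
    by (rule nn_integral_cmult[symmetric]) measurable
  also have "\<dots> = (\<integral>\<^sup>+ \<omega>. (\<integral>\<^sup>+ r \<in> {0<..}. ?p r * (K * F (r *\<^sub>R \<omega>)) \<partial>lborel) \<partial>sphere_measure)"
    by (rule nn_integral_polar[symmetric]) measurable
  also have "\<dots> \<le> (\<integral>\<^sup>+ \<omega>. (\<integral>\<^sup>+ r \<in> {0<..}. ?p r * G (r *\<^sub>R \<omega>) \<partial>lborel) \<partial>sphere_measure)"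
    by (intro nn_integral_mono ray) (simp add: space_sphere_measure)
  also have "\<dots> = (\<integral>\<^sup>+ x. G x \<partial>lborel)" by (rule nn_integral_polar) measurable
  finally show ?thesis by (simp add: K_def F_def G_def a_def)
qed


section \<open>The angular part and the theorem\<close>

lemma nn_integral_L2:
  assumes "f \<in> L2 M"
  shows "(\<integral>\<^sup>+ x. ennreal ((cmod (f x))\<^sup>2) \<partial>M) = ennreal ((l2_norm M f)\<^sup>2)"
  unfolding l2_norm_power2 using assms by (intro nn_integral_eq_integral) (auto simp: L2_def)

text \<open>On the sphere of radius \<open>r\<close> the weight is the constant
  \<open>r powr - b\<close>, so the bound for the slices carries over to weighted norms. The slices
  are controlled for almost every radius, which calls for polar coordinates with the radial integral
  outside.\<close>

lemma weighted_angular_bound: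
  fixes \<psi> g :: "'a::euclidean_space \<Rightarrow> complex"
  assumes [measurable]: "\<psi> \<in> borel_measurable borel" "g \<in> borel_measurable borel"
    and c: "c \<ge> 0"
    and slices: "AE r in lborel. 0 < r \<longrightarrow> slice \<psi> r \<in> L2 sphere_measure \<and> slice g r \<in> L2 sphere_measure \<and>
       c * (l2_norm sphere_measure (slice \<psi> r))\<^sup>2 \<le> (l2_norm sphere_measure (slice g r))\<^sup>2"
  shows "ennreal c * (\<integral>\<^sup>+ x. ennreal ((cmod (\<psi> x))\<^sup>2 / norm x powr b) \<partial>lborel)
    \<le> (\<integral>\<^sup>+ x. ennreal ((cmod (g x))\<^sup>2 / norm x powr b) \<partial>lborel)"
proof -
  let ?p = "\<lambda>r::real. ennreal (r ^ (DIM('a) - 1))"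
  \<comment> \<open>The factor \<open>k\<close> lets one computation serve both sides:
    \<open>k = c\<close> for \<open>\<psi>\<close> and \<open>k = 1\<close> for
    \<open>g\<close>.\<close>
  have sph: "(\<integral>\<^sup>+ \<omega>. ennreal k * ennreal ((cmod (f (r *\<^sub>R \<omega>)))\<^sup>2 / norm (r *\<^sub>R \<omega>) powr b) \<partial>sphere_measure)
      = ennreal (r powr - b) * ennreal (k * (l2_norm sphere_measure (slice f r))\<^sup>2)"
    if [measurable]: "f \<in> borel_measurable borel" and r: "r > 0" and f: "slice f r \<in> L2 sphere_measure"
      and k: "k \<ge> 0" for f :: "'a \<Rightarrow> complex" and r k :: real
  proof -
    have "(\<integral>\<^sup>+ \<omega>. ennreal k * ennreal ((cmod (f (r *\<^sub>R \<omega>)))\<^sup>2 / norm (r *\<^sub>R \<omega>) powr b) \<partial>sphere_measure)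
       = (\<integral>\<^sup>+ \<omega>. ennreal (r powr - b * k) * ennreal ((cmod (slice f r \<omega>))\<^sup>2) \<partial>sphere_measure)"
    proof (rule nn_integral_cong)
      fix \<omega> :: 'a assume "\<omega> \<in> space sphere_measure"
      then have "norm \<omega> = 1" by (simp add: space_sphere_measure)
      then show "ennreal k * ennreal ((cmod (f (r *\<^sub>R \<omega>)))\<^sup>2 / norm (r *\<^sub>R \<omega>) powr b)
          = ennreal (r powr - b * k) * ennreal ((cmod (slice f r \<omega>))\<^sup>2)"
        using r k by (simp add: slice_def powr_minus field_simps flip: ennreal_mult)
    qed
    also have "\<dots> = ennreal (r powr - b * k) * (\<integral>\<^sup>+ \<omega>. ennreal ((cmod (slice f r \<omega>))\<^sup>2) \<partial>sphere_measure)"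
      using f by (intro nn_integral_cmult) (auto simp: L2_def)
    also have "\<dots> = ennreal (r powr - b) * ennreal (k * (l2_norm sphere_measure (slice f r))\<^sup>2)"
      using k by (simp add: nn_integral_L2[OF f] mult_ac flip: ennreal_mult)
    finally show ?thesis .
  qed
  have "ennreal c * (\<integral>\<^sup>+ x. ennreal ((cmod (\<psi> x))\<^sup>2 / norm x powr b) \<partial>lborel)
      = (\<integral>\<^sup>+ x. ennreal c * ennreal ((cmod (\<psi> x))\<^sup>2 / norm x powr b) \<partial>lborel)"
    by (rule nn_integral_cmult[symmetric]) measurable
  also have "\<dots> = (\<integral>\<^sup>+ r \<in> {0<..}. ?p r * (\<integral>\<^sup>+ \<omega>. ennreal c * ennreal ((cmod (\<psi> (r *\<^sub>R \<omega>)))\<^sup>2 / norm (r *\<^sub>R \<omega>) powr b) \<partial>sphere_measure) \<partial>lborel)"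
    by (rule nn_integral_polar'[symmetric]) measurable
  also have "\<dots> \<le> (\<integral>\<^sup>+ r \<in> {0<..}. ?p r * (\<integral>\<^sup>+ \<omega>. ennreal 1 * ennreal ((cmod (g (r *\<^sub>R \<omega>)))\<^sup>2 / norm (r *\<^sub>R \<omega>) powr b) \<partial>sphere_measure) \<partial>lborel)"
  proof (rule nn_integral_mono_AE)
    show "AE r in lborel. ?p r * (\<integral>\<^sup>+ \<omega>. ennreal c * ennreal ((cmod (\<psi> (r *\<^sub>R \<omega>)))\<^sup>2 / norm (r *\<^sub>R \<omega>) powr b) \<partial>sphere_measure) * indicator {0<..} r
      \<le> ?p r * (\<integral>\<^sup>+ \<omega>. ennreal 1 * ennreal ((cmod (g (r *\<^sub>R \<omega>)))\<^sup>2 / norm (r *\<^sub>R \<omega>) powr b) \<partial>sphere_measure) * indicator {0<..} r"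
      using slices
    proof eventually_elim
      case (elim r)
      show ?case
      proof (cases "r > 0")
        case True
        then have "slice \<psi> r \<in> L2 sphere_measure" "slice g r \<in> L2 sphere_measure"
          "c * (l2_norm sphere_measure (slice \<psi> r))\<^sup>2 \<le> 1 * (l2_norm sphere_measure (slice g r))\<^sup>2"
          using elim by auto
        then show ?thesis using True c
          by (subst sph, simp_all only: assms(1,2) zero_le_one)+
             (auto intro!: mult_left_mono mult_right_mono ennreal_leI)
      qed simp
    qed
  qed
  also have "\<dots> = (\<integral>\<^sup>+ x. ennreal 1 * ennreal ((cmod (g x))\<^sup>2 / norm x powr b) \<partial>lborel)"
    by (rule nn_integral_polar') measurable
  finally show ?thesis by simp
qed

text \<open>\<open>LEAST\<close> has the intended value only if a minimum exists. A minimizer over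
  the finite set of indices with \<open>lam m \<le> lam j\<close> is a minimizer over all of
  \<open>I\<close>, as every other eigenvalue exceeds \<open>lam j\<close>.\<close>

lemma hardy_const_le:
  assumes fin: "\<And>R. finite {m \<in> I. lam m \<le> R}" and "j \<in> I"
  shows "hardy_const d \<beta> I lam \<le> lam j + ((d - \<beta> - 2) / 2)\<^sup>2"
proof -
  define k where "k = ((d - \<beta> - 2) / 2)\<^sup>2"
  define A where "A = {m \<in> I. lam m \<le> lam j}"
  have "finite A" "A \<noteq> {}" using fin \<open>j \<in> I\<close> by (auto simp: A_def)
  then obtain i where i: "i \<in> A" "\<And>m. m \<in> A \<Longrightarrow> lam i \<le> lam m"
    using arg_min_if_finite[of A lam] by (metis not_le)
  have "lam i \<le> lam m" if "m \<in> I" for m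
    using i i(2)[of m] that unfolding A_def by (cases "lam m \<le> lam j") auto
  then have "hardy_const d \<beta> I lam = lam i + k"
    using i(1) unfolding hardy_const_def k_def A_def by (intro Least_equality) auto
  then show ?thesis using i(1) by (simp add: A_def k_def)
qed

theorem theorem1p7:
  fixes \<Lambda> sqrt\<Lambda> :: "(real ^ 'n) l2_op"
    and I :: "'i set" and lam :: "'i \<Rightarrow> real" and u :: "'i \<Rightarrow> real ^ 'n \<Rightarrow> complex"
    and \<beta> :: real and \<psi> g :: "real ^ 'n \<Rightarrow> complex"
  assumes "CARD('n) \<ge> 2"
    and "self_adjoint_op sphere_measure \<Lambda>" and "nonneg_op sphere_measure \<Lambda>"
    and "purely_discrete_spectrum sphere_measure \<Lambda> I lam u"
    and "nonneg_sqrt_op sphere_measure \<Lambda> sqrt\<Lambda>"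
    and "\<psi> \<in> dom_L \<Lambda>"
    and "angular_image sqrt\<Lambda> \<psi> g"
    and "(\<lambda>x. complex_of_real (norm x powr (- \<beta> / 2) * sqrt (first_order_op g \<psi> x))) \<in> L2 lborel"
  shows "(LINT x|lborel. first_order_op g \<psi> x / norm x powr \<beta>)
    \<ge> hardy_const (real CARD('n)) \<beta> I lam * (LINT x|lborel. (cmod (\<psi> x))\<^sup>2 / norm x powr (\<beta> + 2))"
proof -
  define k where "k = ((real CARD('n) - \<beta> - 2) / 2)\<^sup>2"
  define H where "H = hardy_const (real CARD('n)) \<beta> I lam"
  \<comment> \<open>For nonempty \<open>I\<close> the difference \<open>H - k\<close> is the lowest
    eigenvalue. Taking the maximum with 0 gives a nonnegative constant for extended nonnegative
    arithmetic; the case \<open>c = 0\<close> only says that squared norms are nonnegative.\<close>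
  define c where "c = max 0 (H - k)"
  have "k \<ge> 0" "c \<ge> 0" "H \<le> c + k" by (auto simp: k_def c_def)
  have \<psi>: "\<psi> \<in> test_functions" and dom: "\<And>r. r > 0 \<Longrightarrow> slice \<psi> r \<in> Domain \<Lambda>"
    using assms(6) by (auto simp: dom_L_def)
  have [measurable]: "g \<in> borel_measurable borel"
    and gS: "AE r in lborel. 0 < r \<longrightarrow> (slice \<psi> r, slice g r) \<in> sqrt\<Lambda>"
    using assms(7) by (auto simp: angular_image_def)
  have [measurable]: "\<psi> \<in> borel_measurable borel" "radial_deriv \<psi> \<in> borel_measurable borel"
    by (auto intro: borel_measurable_continuous_onI test_functions_C1 radial_deriv_borel_measurable \<psi>)
  have spec: "H - k \<le> x" if x: "complex_of_real x \<in> spectrum_op sphere_measure \<Lambda>" for x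
  proof -
    have "spectrum_op sphere_measure \<Lambda> = complex_of_real ` lam ` I"
      using assms(4) by (simp add: purely_discrete_spectrum_def)
    then obtain j where "j \<in> I" "x = lam j" using x by auto
    moreover have "finite {m \<in> I. lam m \<le> R}" for R
      using assms(4) by (simp add: purely_discrete_spectrum_def)
    ultimately show ?thesis using hardy_const_le[of I lam j "real CARD('n)" \<beta>] by (simp add: H_def k_def)
  qed
  have saS: "self_adjoint_op sphere_measure sqrt\<Lambda>" using assms(5) by (simp add: nonneg_sqrt_op_def)
  have slices: "AE r in lborel. 0 < r \<longrightarrow> slice \<psi> r \<in> L2 sphere_measure \<and> slice g r \<in> L2 sphere_measure \<and>
       c * (l2_norm sphere_measure (slice \<psi> r))\<^sup>2 \<le> (l2_norm sphere_measure (slice g r))\<^sup>2"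
    using gS
  proof eventually_elim
    case (elim r)
    show ?case
    proof
      assume "0 < r"
      with elim have S: "(slice \<psi> r, slice g r) \<in> sqrt\<Lambda>" by simp
      have "(H - k) * (l2_norm sphere_measure (slice \<psi> r))\<^sup>2 \<le> (l2_norm sphere_measure (slice g r))\<^sup>2"
        by (rule sqrt_op_lower_bound[OF assms(2,3,5) spec dom[OF \<open>0 < r\<close>] S])
      then show "slice \<psi> r \<in> L2 sphere_measure \<and> slice g r \<in> L2 sphere_measure \<and>
          c * (l2_norm sphere_measure (slice \<psi> r))\<^sup>2 \<le> (l2_norm sphere_measure (slice g r))\<^sup>2"
        using self_adjoint_op_L2[OF saS S] by (auto simp: c_def max_def)
    qed
  qed
  define f where "f x = first_order_op g \<psi> x / norm x powr \<beta>" for x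
  define q where "q x = (cmod (\<psi> x))\<^sup>2 / norm x powr (\<beta> + 2)" for x
  have f_nonneg: "f x \<ge> 0" and q_nonneg: "q x \<ge> 0" for x
    by (auto simp: f_def q_def first_order_op_def)
  \<comment> \<open>The square of the function in the last hypothesis is \<open>f\<close>.\<close>
  have f_int: "integrable lborel f"
  proof -
    have "(cmod (complex_of_real (norm x powr (- \<beta> / 2) * sqrt (first_order_op g \<psi> x))))\<^sup>2 = f x" for x
    proof -
      have "(norm x powr (- \<beta> / 2))\<^sup>2 = norm x powr - \<beta>"
        by (simp add: power2_eq_square flip: powr_add)
      moreover have "first_order_op g \<psi> x \<ge> 0" by (simp add: first_order_op_def)
      ultimately show ?thesis
        unfolding norm_of_real power2_abs power_mult_distrib
        by (simp add: f_def powr_minus field_simps)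
    qed
    then show ?thesis using assms(8) by (simp add: L2_def)
  qed
  have split: "ennreal (f x) = ennreal ((cmod (radial_deriv \<psi> x))\<^sup>2 / norm x powr \<beta>)
      + ennreal ((cmod (g x))\<^sup>2 / norm x powr (\<beta> + 2))" for x
  proof -
    \<comment> \<open>The angular term of \<open>first_order_op\<close> brings a further
      \<open>|x|^(-2)\<close>, hence the same exponent \<open>\<beta> + 2\<close> as in
      \<open>q\<close>. At the origin both sides are 0, since \<open>0 powr b = 0\<close> and
      division by 0 gives 0.\<close>
    have "f x = (cmod (radial_deriv \<psi> x))\<^sup>2 / norm x powr \<beta> + (cmod (g x))\<^sup>2 / norm x powr (\<beta> + 2)"
      by (cases "x = 0") (simp_all add: f_def first_order_op_def powr_add add_divide_distrib mult.commute)
    then show ?thesis by simp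
  qed
  have "ennreal (c + k) * (\<integral>\<^sup>+ x. ennreal (q x) \<partial>lborel)
      = ennreal k * (\<integral>\<^sup>+ x. ennreal (q x) \<partial>lborel) + ennreal c * (\<integral>\<^sup>+ x. ennreal (q x) \<partial>lborel)"
    using \<open>k \<ge> 0\<close> \<open>c \<ge> 0\<close> by (simp add: distrib_right add.commute)
  also have "\<dots> \<le> (\<integral>\<^sup>+ x. ennreal ((cmod (radial_deriv \<psi> x))\<^sup>2 / norm x powr \<beta>) \<partial>lborel)
      + (\<integral>\<^sup>+ x. ennreal ((cmod (g x))\<^sup>2 / norm x powr (\<beta> + 2)) \<partial>lborel)"
    unfolding q_def
  proof (rule add_mono)
    show "ennreal k * (\<integral>\<^sup>+ x. ennreal ((cmod (\<psi> x))\<^sup>2 / norm x powr (\<beta> + 2)) \<partial>lborel)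
        \<le> (\<integral>\<^sup>+ x. ennreal ((cmod (radial_deriv \<psi> x))\<^sup>2 / norm x powr \<beta>) \<partial>lborel)"
      using radial_Hardy[OF \<psi>, of \<beta>] by (simp add: k_def)
  qed (rule weighted_angular_bound[OF _ _ \<open>c \<ge> 0\<close> slices]; measurable)
  also have "\<dots> = (\<integral>\<^sup>+ x. ennreal (f x) \<partial>lborel)"
    unfolding split by (rule nn_integral_add[symmetric]) measurable
  also have "\<dots> = ennreal (LINT x|lborel. f x)"
    using f_int f_nonneg by (intro nn_integral_eq_integral) auto
  finally have le: "ennreal (c + k) * (\<integral>\<^sup>+ x. ennreal (q x) \<partial>lborel) \<le> ennreal (LINT x|lborel. f x)" .
  have f0: "0 \<le> (LINT x|lborel. f x)" and q0: "0 \<le> (LINT x|lborel. q x)"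
    using f_nonneg q_nonneg by simp_all
  have "H * (LINT x|lborel. q x) \<le> (LINT x|lborel. f x)"
  proof (cases "integrable lborel q")
    case True
    then have "(\<integral>\<^sup>+ x. ennreal (q x) \<partial>lborel) = ennreal (LINT x|lborel. q x)"
      using q_nonneg by (intro nn_integral_eq_integral) auto
    then have "(c + k) * (LINT x|lborel. q x) \<le> (LINT x|lborel. f x)"
      using le f0 q0 \<open>c \<ge> 0\<close> \<open>k \<ge> 0\<close> by (simp del: ennreal_plus flip: ennreal_mult)
    then show ?thesis using mult_right_mono[OF \<open>H \<le> c + k\<close> q0] by linarith
  next
    \<comment> \<open>The integral of a non-integrable function is 0 by convention, so only
      nonnegativity of the left-hand integral is left to use.\<close>
    case False
    then show ?thesis using f0 by (simp add: not_integrable_integral_eq)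
  qed
  then show ?thesis by (simp add: H_def f_def q_def)
qed

end
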